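(* Let $C\ge 2$ be an integer and let $0<\rho_1<C$. \begin{enumerate} \item For every $\rho_2\in[0,C)$ there is a unique root $z(\rho_1,\rho_2)>0$ of $\Phi_{\rho_1,\rho_2}$ in $(0,+\infty)$. The function $\rho_2\mapsto z(\rho_1,\rho_2)$ is increasing on $(0,C)$ and, if $$z(\rho_1,C):=\lim_{\rho_2\nearrow C} z(\rho_1,\rho_2)$$ (an increasing limit in $(0,+\infty]$), then $z(\rho_1,C)$ is the unique root of $\Phi_{\rho_1,C}$ in $(0,+\infty)$ if $\rho_1<C-1$, and $z(\rho_1,C)=+\infty$ otherwise. \item There exists a non-increasing function $\phi_C:(C,+\infty)\to(0,C-1)$ (depending only on $C$) such that $$\lim_{z\to+\infty}\phi_C(z)=0,\qquad \lim_{z\searrow C}\phi_C(z)=C-1,$$ and such that, for every $\rho_2>C$: \begin{enumerate} \item if $\rho_1\in(0,\phi_C(\rho_2))$, then $\Phi_{\rho_1,\rho_2}$ has two roots in $(0,+\infty)$; \item if $\rho_1\in(\phi_C(\rho_2),C)$, then $\Phi_{\rho_1,\rho_2}$ does not have any root in $(0,+\infty)$; \item if $\rho_1=\phi_C(\rho_2)$, then $\Phi_{\rho_1,\rho_2}$ has a unique root in $(0,+\infty)$. \end{enumerate} \end{enumerate}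
   Context: For an integer $C\ge 1$, $\rho_1>0$, $\rho_2\ge 0$ and $z>0$, $$\Phi_{\rho_1,\rho_2}(z):=\frac{1}{z}\,\frac{(\rho_1+\rho_2 z)^C}{C!}-\sum_{m=0}^{C-1}\frac{(\rho_1+\rho_2 z)^m}{m!}.$$ *)

theory Defs
  imports Complex_Main "HOL-Library.Extended_Real" "HOL-Library.FuncSet"
begin

definition Phi :: "nat \<Rightarrow> real \<Rightarrow> real \<Rightarrow> real \<Rightarrow> real" where
  "Phi C \<rho>1 \<rho>2 z =
     (1 / z) * ((\<rho>1 + \<rho>2 * z) ^ C / fact C) - (\<Sum>m<C. (\<rho>1 + \<rho>2 * z) ^ m / fact m)"

definition Phi_roots :: "nat \<Rightarrow> real \<Rightarrow> real \<Rightarrow> real set" where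
  "Phi_roots C \<rho>1 \<rho>2 = {z. 0 < z \<and> Phi C \<rho>1 \<rho>2 z = 0}"

text \<open>The root \<open>z(\<rho>1, \<rho>2)\<close>; meaningful only when \<^const>\<open>Phi_roots\<close> is a singleton.\<close>

definition zroot :: "nat \<Rightarrow> real \<Rightarrow> real \<Rightarrow> real" where
  "zroot C \<rho>1 \<rho>2 = (THE z. z \<in> Phi_roots C \<rho>1 \<rho>2)"

text \<open>The boundary value \<open>z(\<rho>1, C)\<close> is a limit from the left in the extended reals, not
  \<open>zroot C \<rho>1 C\<close>; it is meaningful only when that limit exists.\<close>

definition zroot_limit :: "nat \<Rightarrow> real \<Rightarrow> ereal" where
  "zroot_limit C \<rho>1 = Lim (at_left (real C)) (\<lambda>\<rho>2. ereal (zroot C \<rho>1 \<rho>2))"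

end

theory Submission
  imports Defs "HOL-Computational_Algebra.Polynomial"
begin

text \<open>
  Put \<open>u = \<rho>1 + \<rho>2 z\<close>, \<open>v = 1 / u\<close>, \<open>N = C - 1\<close> and \<open>Q(v) = \<Sum>k\<le>N. N! / (N - k)! v\<^sup>k\<close>. Since
  \<open>\<Sum>m<C. u\<^sup>m / m! = u\<^sup>N / N! Q(1 / u)\<close>, the equation \<open>\<Phi> = 0\<close> reads \<open>z = B(v) / (C v)\<close> with
  \<open>B = 1 / Q\<close>, that is, \<open>s B(v) + \<rho>1 v = 1\<close> with \<open>s = \<rho>2 / C\<close>. The crucial point is that \<open>B\<close> is
  strictly convex: the coefficients of \<open>2 Q'\<^sup>2 - Q Q''\<close> are nonnegative because of the log-concavity
  of the coefficients of \<open>Q\<close>. As \<open>B(0) = 1\<close> and \<open>B'(0) = -N\<close>, the left-hand side is a strictly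
  convex function of \<open>v\<close> with value \<open>s\<close> and slope \<open>\<rho>1 - s N\<close> at \<open>0\<close>, tending to infinity; this
  settles \<open>s < 1\<close> and \<open>s = 1\<close>. For \<open>s > 1\<close> the number of solutions depends on the position of
  \<open>\<rho>1\<close> relative to \<open>\<phi>(\<rho>2) = max\<^sub>v (1 - s B(v)) / v\<close>.
\<close>

section \<open>Chebyshev's sum inequality and log-concavity of the coefficients\<close>

lemma Chebyshev_sum_similarly_ordered:
  fixes a b :: "nat \<Rightarrow> real"
  assumes "\<And>i j. i \<le> n \<Longrightarrow> j \<le> n \<Longrightarrow> 0 \<le> (a i - a j) * (b i - b j)"
  shows "(\<Sum>i\<le>n. a i) * (\<Sum>i\<le>n. b i) \<le> real (Suc n) * (\<Sum>i\<le>n. a i * b i)"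
proof -
  \<comment> \<open>Each summand is nonnegative, and the double sum expands to twice the difference
    of the two sides of the claim.\<close>
  have "0 \<le> (\<Sum>i\<le>n. \<Sum>j\<le>n. (a i - a j) * (b i - b j))"
    using assms by (intro sum_nonneg) auto
  also have "\<dots> = 2 * (real (Suc n) * (\<Sum>i\<le>n. a i * b i) - (\<Sum>i\<le>n. a i) * (\<Sum>i\<le>n. b i))"
    by (simp only: one_add_one[symmetric] algebra_simps)
       (simp add: algebra_simps sum_subtractf sum.distrib sum.swap[of "\<lambda>i j. a i * b j"] sum_distrib_left)
  finally show ?thesis by simp
qed

definition erlang_poly :: "nat \<Rightarrow> real poly" where
  "erlang_poly N = (\<Sum>k\<le>N. monom (fact k * real (N choose k)) k)"

lemma coeff_erlang_poly: "coeff (erlang_poly N) k = fact k * real (N choose k)"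
  by (simp add: erlang_poly_def coeff_sum)

lemma coeff_erlang_poly_Suc:
  "coeff (erlang_poly N) (Suc k) = (real N - real k) * coeff (erlang_poly N) k"
proof (cases "k \<le> N")
  case True
  have "real (Suc k) * real (N choose Suc k) = (real N - real k) * real (N choose k)"
    using True by (metis binomial_absorb_comp binomial_absorption of_nat_diff of_nat_mult choose_reduce_nat)
  then have "fact k * (real (Suc k) * real (N choose Suc k)) = fact k * ((real N - real k) * real (N choose k))"
    by simp
  then show ?thesis by (simp only: coeff_erlang_poly fact_Suc of_nat_mult mult_ac)
qed (simp add: coeff_erlang_poly binomial_eq_0)

lemma coeff_erlang_poly_nonneg: "0 \<le> coeff (erlang_poly N) k"
  by (simp add: coeff_erlang_poly)

text \<open>Log-concavity in the form in which it is used: by the recurrence, moving both indices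
  one step closer, from (j, m + 1) to (j + 1, m), changes the product by (m - j) times
  \<open>?q j * ?q m\<close>, which is nonnegative as long as j \<le> m.\<close>

lemma coeff_erlang_poly_product_mono:
  assumes "i \<le> j" "2 * j \<le> n"
  shows "coeff (erlang_poly N) i * coeff (erlang_poly N) (n - i)
       \<le> coeff (erlang_poly N) j * coeff (erlang_poly N) (n - j)"
  using assms
proof (induction j rule: dec_induct)
  case (step j)
  let ?q = "coeff (erlang_poly N)"
  define m where "m = n - Suc j"
  have m: "n - j = Suc m" "j \<le> m" using step.prems by (auto simp: m_def)
  have "?q (Suc j) * ?q m - ?q j * ?q (Suc m) = (real m - real j) * (?q j * ?q m)"
    by (simp add: coeff_erlang_poly_Suc algebra_simps)
  also have "\<dots> \<ge> 0" using m by (simp add: coeff_erlang_poly_nonneg)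
  finally show ?case using step m by (simp add: m_def)
qed simp

lemma sum_index_product: "6 * (\<Sum>i\<le>n. real i * (real n - real i)) = real n * (real n + 1) * (real n - 1)"
proof -
  \<comment> \<open>The parameter x is decoupled from the upper limit so that the induction goes
    through; x = n is set afterwards.\<close>
  have "6 * (\<Sum>i\<le>n. real i * (x - real i)) = real n * (real n + 1) * (3 * x - 2 * real n - 1)" for x
    by (induction n) (auto simp: algebra_simps)
  from this[of "real n"] show ?thesis by (simp add: algebra_simps)
qed

text \<open>The weights \<open>6 i (n - i) - n (n - 1)\<close> sum to zero and, like the coefficient products,
  increase towards the middle index; Chebyshev's sum inequality applies.\<close>

lemma weighted_coeff_erlang_poly_product_nonneg:
  "0 \<le> (\<Sum>i\<le>n. (6 * (real i * (real n - real i)) - real n * (real n - 1)) *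
       (coeff (erlang_poly N) i * coeff (erlang_poly N) (n - i)))"
proof -
  define a where "a i = real i * (real n - real i)" for i
  define b where "b i = coeff (erlang_poly N) i * coeff (erlang_poly N) (n - i)" for i
  \<comment> \<open>Both sequences are invariant under i \<mapsto> n - i, so every index can be
    folded into the lower half, where both are increasing.\<close>
  have sym: "a (min i (n - i)) = a i" "b (min i (n - i)) = b i" if "i \<le> n" for i
    using that by (auto simp: a_def b_def min_def)
  have mono: "a i \<le> a j \<and> b i \<le> b j" if "i \<le> j" "2 * j \<le> n" for i j
  proof -
    have "a j - a i = (real j - real i) * (real n - real i - real j)"
      by (simp add: a_def algebra_simps)
    also have "\<dots> \<ge> 0" using that by (intro mult_nonneg_nonneg) auto
    finally show ?thesis
      using coeff_erlang_poly_product_mono[OF that] by (simp add: b_def)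
  qed
  have "0 \<le> (a i - a j) * (b i - b j)" if ij: "i \<le> n" "j \<le> n" for i j
  proof -
    let ?i = "min i (n - i)" and ?j = "min j (n - j)"
    have bound: "2 * ?i \<le> n" "2 * ?j \<le> n" by auto
    have "0 \<le> (a ?i - a ?j) * (b ?i - b ?j)"
      using mono[of ?i ?j] mono[of ?j ?i] le_cases[of ?i ?j] bound
      by (metis diff_ge_0_iff_ge diff_le_0_iff_le mult_nonneg_nonneg mult_nonpos_nonpos)
    then show ?thesis using ij by (simp add: sym)
  qed
  from Chebyshev_sum_similarly_ordered[of n a b, OF this]
  have "6 * (\<Sum>i\<le>n. a i) * (\<Sum>i\<le>n. b i) \<le> real (Suc n) * (6 * (\<Sum>i\<le>n. a i * b i))"
    by simp
  \<comment> \<open>Thus n (n - 1) is the mean of \<open>6 * a i\<close>, which explains the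
    constant subtracted in the weights.\<close>
  moreover have "6 * (\<Sum>i\<le>n. a i) = real (Suc n) * (real n * (real n - 1))"
    using sum_index_product[of n] by (simp add: a_def[symmetric] ac_simps)
  ultimately have "real (Suc n) * (real n * (real n - 1) * (\<Sum>i\<le>n. b i))
      \<le> real (Suc n) * (6 * (\<Sum>i\<le>n. a i * b i))"
    by (simp only: mult.assoc)
  then have "real n * (real n - 1) * (\<Sum>i\<le>n. b i) \<le> 6 * (\<Sum>i\<le>n. a i * b i)"
    by (subst (asm) mult_le_cancel_left_pos) auto
  then show ?thesis
    unfolding a_def[symmetric] b_def[symmetric]
    by (simp add: sum_subtractf sum_distrib_left left_diff_distrib mult.assoc)
qed

section \<open>Growth of the polynomial and its convexity discriminant\<close>

lemma poly_erlang_poly_ge: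
  assumes "0 \<le> v"
  shows "1 + real N * v \<le> poly (erlang_poly N) v"
proof (cases "N = 0")
  case False
  have "1 + real N * v = (\<Sum>k\<in>{0, 1}. poly (monom (fact k * real (N choose k)) k) v)"
    by (simp add: poly_monom)
  also have "\<dots> \<le> (\<Sum>k\<le>N. poly (monom (fact k * real (N choose k)) k) v)"
    using assms False by (intro sum_mono2) (auto simp: poly_monom)
  finally show ?thesis by (simp add: erlang_poly_def poly_sum)
qed (simp add: erlang_poly_def poly_monom)

lemma poly_erlang_poly_ge_1:
  assumes "0 \<le> v"
  shows "1 \<le> poly (erlang_poly N) v"
proof -
  have "0 \<le> real N * v" using assms by simp
  then show ?thesis using poly_erlang_poly_ge[OF assms, of N] by linarith
qed

lemma poly_erlang_poly_strict_mono:
  assumes "N \<ge> 1" "0 \<le> v" "v < w"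
  shows "poly (erlang_poly N) v < poly (erlang_poly N) w"
  unfolding erlang_poly_def poly_sum
proof (rule sum_strict_mono_ex1)
  show "\<exists>k\<in>{..N}. poly (monom (fact k * real (N choose k)) k) v
      < poly (monom (fact k * real (N choose k)) k) w"
    using assms by (intro bexI[of _ 1]) (auto simp: poly_monom)
qed (use assms in \<open>auto simp: poly_monom intro!: mult_left_mono power_mono\<close>)

lemma erlang_poly_convexity_discriminant:
  fixes N defines "Q \<equiv> erlang_poly N"
  assumes "N \<ge> 1" "0 < v"
  shows "poly Q v * poly (pderiv (pderiv Q)) v < 2 * (poly (pderiv Q) v)\<^sup>2"
proof -
  define A where "A = pCons 0 (pderiv Q)"
  define B where "B = pCons 0 (pCons 0 (pderiv (pderiv Q)))"
  \<comment> \<open>As a polynomial, T is 2 v^2 (2 Q'^2 - Q Q''). The powers of v align the degrees,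
    and writing the mixed product in both orders symmetrises the coefficients: 4 i (n - i) - i (i -
    1) - (n - i) (n - i - 1) is the weight 6 i (n - i) - n (n - 1).\<close>
  define T where "T = smult 4 (A * A) - Q * B - B * Q"
  let ?q = "coeff Q"
  have cA: "coeff A i = real i * ?q i" for i
    by (cases i) (simp_all add: A_def coeff_pderiv)
  have cB: "coeff B i = real i * (real i - 1) * ?q i" for i
    by (cases i; cases "i - 1") (simp_all add: B_def coeff_pderiv coeff_pCons split: nat.splits)
  have cT: "coeff T n = (\<Sum>i\<le>n. (6 * (real i * (real n - real i)) - real n * (real n - 1)) *
       (?q i * ?q (n - i)))" for n
    unfolding T_def coeff_diff coeff_smult coeff_mult sum_distrib_left sum_subtractf[symmetric]
    by (intro sum.cong refl) (auto simp: cA cB of_nat_diff algebra_simps)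
  have nonneg: "0 \<le> coeff T n" for n
    unfolding cT Q_def by (rule weighted_coeff_erlang_poly_product_nonneg)
  have q: "?q 0 = 1" "?q 1 = real N" "?q 2 = real N * (real N - 1)"
    using coeff_erlang_poly_Suc[of N 0] coeff_erlang_poly_Suc[of N 1]
    by (simp_all add: Q_def coeff_erlang_poly numeral_2_eq_2)
  \<comment> \<open>Strictness comes from this single coefficient; the others only have to be
    nonnegative.\<close>
  have "coeff T 2 = 4 * real N"
    unfolding cT using q by (simp add: numeral_2_eq_2 algebra_simps)
  then have c2: "coeff T 2 > 0" using assms by simp
  then have "2 \<le> degree T" by (intro le_degree) auto
  have "0 < coeff T 2 * v ^ 2" using c2 \<open>0 < v\<close> by simp
  also have "\<dots> = (\<Sum>i\<in>{2}. coeff T i * v ^ i)" by simp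
  also have "\<dots> \<le> (\<Sum>i\<le>degree T. coeff T i * v ^ i)"
    using \<open>2 \<le> degree T\<close> \<open>0 < v\<close> nonneg by (intro sum_mono2) auto
  also have "\<dots> = poly T v" by (simp add: poly_altdef)
  also have "\<dots> = 2 * v\<^sup>2 * (2 * (poly (pderiv Q) v)\<^sup>2 - poly Q v * poly (pderiv (pderiv Q)) v)"
    by (simp add: T_def A_def B_def power2_eq_square algebra_simps)
  finally show ?thesis using \<open>0 < v\<close> by (simp add: zero_less_mult_iff)
qed

section \<open>The blocking probability: strict convexity and behaviour at 0\<close>

text \<open>The Erlang blocking probability of \<open>N\<close> servers at offered load \<open>1 / v\<close>; the reciprocal of
  the load is the variable in which it is convex.\<close>

definition erlang_B :: "nat \<Rightarrow> real \<Rightarrow> real" where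
  "erlang_B N v = 1 / poly (erlang_poly N) v"

text \<open>The chord inequality with denominators cleared. The left point may be 0, because chords
  and tangents from 0 decide the number of solutions.\<close>

definition strictly_convex_on_ray :: "(real \<Rightarrow> real) \<Rightarrow> bool" where
  "strictly_convex_on_ray f \<longleftrightarrow>
     (\<forall>a b c. 0 \<le> a \<longrightarrow> a < b \<longrightarrow> b < c \<longrightarrow> (c - a) * f b < (c - b) * f a + (b - a) * f c)"

lemma strictly_convex_on_rayD:
  "strictly_convex_on_ray f \<Longrightarrow> 0 \<le> a \<Longrightarrow> a < b \<Longrightarrow> b < c \<Longrightarrow>
     (c - a) * f b < (c - b) * f a + (b - a) * f c"
  by (simp add: strictly_convex_on_ray_def)

text \<open>By the mean value theorem the chord slopes on the two sides of b are values of f' at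
  points p < b < q. Both points are interior, so at 0 continuity is enough.\<close>

lemma strictly_convex_on_rayI_deriv:
  fixes f :: "real \<Rightarrow> real"
  assumes cont: "continuous_on {0..} f"
    and deriv: "\<And>x. 0 < x \<Longrightarrow> (f has_real_derivative f' x) (at x)"
    and mono: "\<And>x y. 0 < x \<Longrightarrow> x < y \<Longrightarrow> f' x < f' y"
  shows "strictly_convex_on_ray f"
  unfolding strictly_convex_on_ray_def
proof (intro allI impI)
  fix a b c :: real assume abc: "0 \<le> a" "a < b" "b < c"
  have slope: "\<exists>z>x. z < y \<and> f y - f x = (y - x) * f' z" if "0 \<le> x" "x < y" for x y
  proof -
    have "continuous_on {x..y} f"
      by (rule continuous_on_subset[OF cont]) (use that in auto)
    moreover have "f differentiable (at z)" if "x < z" for z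
      using deriv[of z] \<open>0 \<le> x\<close> that by (auto simp: real_differentiable_def)
    ultimately obtain l z where
      z: "x < z" "z < y" "(f has_real_derivative l) (at z)" "f y - f x = (y - x) * l"
      using MVT[OF \<open>x < y\<close>, of f] by blast
    have "l = f' z" using z(3) deriv[of z] z(1) that by (auto intro: DERIV_unique)
    then show ?thesis using z by auto
  qed
  obtain p where p: "a < p" "p < b" "f b - f a = (b - a) * f' p"
    using slope[of a b] abc by auto
  obtain q where q: "b < q" "q < c" "f c - f b = (c - b) * f' q"
    using slope[of b c] abc by auto
  have "f' p < f' q" using p q abc by (intro mono) auto
  then have "(c - b) * (b - a) * f' p < (c - b) * (b - a) * f' q"
    using abc by simp
  then have "(c - b) * (f b - f a) < (b - a) * (f c - f b)"
    by (simp add: p q algebra_simps)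
  then show "(c - a) * f b < (c - b) * f a + (b - a) * f c"
    by (simp add: algebra_simps)
qed

lemma DERIV_erlang_B:
  assumes "0 \<le> v"
  shows "(erlang_B N has_real_derivative
     - poly (pderiv (erlang_poly N)) v / (poly (erlang_poly N) v)\<^sup>2) (at v)"
  using poly_erlang_poly_ge_1[OF assms, of N] unfolding erlang_B_def
  by (auto intro!: derivative_eq_intros poly_DERIV simp: power2_eq_square)

lemma continuous_on_erlang_B: "continuous_on {0..} (erlang_B N)"
  by (rule DERIV_continuous_on[OF DERIV_subset[OF DERIV_erlang_B]]) auto

lemma strictly_convex_erlang_B:
  assumes "N \<ge> 1"
  shows "strictly_convex_on_ray (erlang_B N)"
proof (rule strictly_convex_on_rayI_deriv)
  fix x y :: real assume xy: "0 < x" "x < y"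
  let ?Q = "erlang_poly N"
  let ?Q1 = "pderiv ?Q"
  let ?Q2 = "pderiv ?Q1"
  show "- poly ?Q1 x / (poly ?Q x)\<^sup>2 < - poly ?Q1 y / (poly ?Q y)\<^sup>2"
  proof (rule DERIV_pos_imp_increasing[OF \<open>x < y\<close>])
    fix v assume "x \<le> v" "v \<le> y"
    then have v: "0 < v" using xy by simp
    have Q: "0 < poly ?Q v" using poly_erlang_poly_ge_1[of v N] v by simp
    \<comment> \<open>This is (1 / Q)''; its numerator is the discriminant shown to be positive
      above.\<close>
    let ?d = "(2 * (poly ?Q1 v)\<^sup>2 - poly ?Q v * poly ?Q2 v) / (poly ?Q v) ^ 3"
    have "((\<lambda>v. - poly ?Q1 v / (poly ?Q v)\<^sup>2) has_real_derivative ?d) (at v)"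
      using Q by (auto intro!: derivative_eq_intros poly_DERIV simp: field_simps power2_eq_square power3_eq_cube)
    moreover have "0 < ?d"
      using erlang_poly_convexity_discriminant[OF assms v] Q by simp
    ultimately show "\<exists>d. ((\<lambda>v. - poly ?Q1 v / (poly ?Q v)\<^sup>2) has_real_derivative d) (at v) \<and> 0 < d"
      by blast
  qed
qed (use DERIV_erlang_B continuous_on_erlang_B in auto)

lemma erlang_B_0 [simp]: "erlang_B N 0 = 1"
  by (simp add: erlang_B_def poly_0_coeff_0 coeff_erlang_poly)

lemma erlang_B_pos: "0 \<le> v \<Longrightarrow> 0 < erlang_B N v"
  using poly_erlang_poly_ge_1[of v N] by (simp add: erlang_B_def)

lemma erlang_B_strict_antimono:
  assumes "N \<ge> 1" "0 \<le> v" "v < w"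
  shows "erlang_B N w < erlang_B N v"
  using poly_erlang_poly_strict_mono[OF assms] poly_erlang_poly_ge_1[OF assms(2), of N]
  by (simp add: erlang_B_def divide_strict_left_mono)

lemma erlang_B_upper: "0 \<le> v \<Longrightarrow> erlang_B N v \<le> 1 / (1 + real N * v)"
  unfolding erlang_B_def
  by (intro divide_left_mono poly_erlang_poly_ge mult_pos_pos)
     (use poly_erlang_poly_ge_1[of v N] in \<open>auto intro: add_pos_nonneg\<close>)

lemma DERIV_erlang_B_0: "(erlang_B N has_real_derivative - real N) (at 0)"
  using DERIV_erlang_B[of 0 N]
  by (simp add: poly_0_coeff_0 coeff_pderiv coeff_erlang_poly)

text \<open>The sum with the line has value 1 and slope c - N < 0 at 0, so it drops below 1
  immediately to the right.\<close>

lemma erlang_B_below_line: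
  assumes "c < real N"
  obtains v where "0 < v" "erlang_B N v + c * v < 1"
proof -
  have "((\<lambda>v. erlang_B N v + c * v) has_real_derivative - real N + c) (at 0)"
    by (auto intro!: derivative_eq_intros DERIV_erlang_B_0)
  from DERIV_neg_dec_right[OF this] assms obtain d where
    d: "d > 0" "\<And>h. h > 0 \<Longrightarrow> h < d \<Longrightarrow> erlang_B N h + c * h < 1" by auto
  show ?thesis by (rule that[of "d / 2"]) (use d(1) d(2)[of "d / 2"] in auto)
qed

lemma erlang_B_above_tangent:
  assumes "N \<ge> 1" "0 < v"
  shows "1 - real N * v < erlang_B N v"
proof (rule ccontr)
  assume "\<not> ?thesis"
  \<comment> \<open>The chord from 0 to v / 2 has slope -c. Passing to the midpoint turns the
    assumed B(v) \<le> 1 - N v into the strict c > N; convexity then keeps B(h) below 1 - c h for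
    small h, against the slope -N at 0.\<close>
  define c where "c = (1 - erlang_B N (v / 2)) / (v / 2)"
  have B: "erlang_B N (v / 2) = 1 - c * v / 2" using assms by (simp add: c_def field_simps)
  have "v * erlang_B N (v / 2) < v / 2 * 1 + v / 2 * erlang_B N v"
    using strictly_convex_on_rayD[OF strictly_convex_erlang_B[OF assms(1)], of 0 "v / 2" v] assms
    by simp
  then have "v * (erlang_B N (v / 2)) < v * (1 / 2 + erlang_B N v / 2)"
    by (simp add: algebra_simps)
  then have "erlang_B N (v / 2) < 1 / 2 + erlang_B N v / 2"
    using assms by simp
  with \<open>\<not> ?thesis\<close> have "real N * v < c * v"
    unfolding B by (simp add: field_simps)
  then have c: "real N < c" using assms by simp
  have "((\<lambda>v. erlang_B N v + c * v) has_real_derivative - real N + c) (at 0)"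
    by (auto intro!: derivative_eq_intros DERIV_erlang_B_0)
  from DERIV_pos_inc_right[OF this] c obtain d where
    d: "d > 0" "\<And>h. h > 0 \<Longrightarrow> h < d \<Longrightarrow> 1 < erlang_B N h + c * h" by auto
  define h where "h = min (d / 2) (v / 4)"
  have h: "0 < h" "h < d" "h < v / 2" using d(1) assms by (auto simp: h_def min_def)
  have "v / 2 * erlang_B N h < (v / 2 - h) + h * erlang_B N (v / 2)"
    using strictly_convex_on_rayD[OF strictly_convex_erlang_B[OF assms(1)], of 0 h "v / 2"] h
    by simp
  also have "\<dots> = v / 2 * (1 - c * h)" unfolding B by (simp add: algebra_simps)
  finally have "erlang_B N h < 1 - c * h"
    using assms by (subst (asm) mult_less_cancel_left_pos) auto
  with d(2)[of h] h show False by simp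
qed

section \<open>Reduction to an equation in the reciprocal load\<close>

text \<open>With \<open>v = 1 / (\<rho>1 + \<rho>2 z)\<close>, \<open>N = C - 1\<close> and \<open>s = \<rho>2 / C\<close>, the equation \<open>\<Phi> = 0\<close> becomes
  \<open>root_fun N \<rho>1 s v = 1\<close>, and \<open>z\<close> is recovered as \<open>root_of_inv C v\<close>.\<close>

definition root_fun :: "nat \<Rightarrow> real \<Rightarrow> real \<Rightarrow> real \<Rightarrow> real" where
  "root_fun N \<rho> s v = s * erlang_B N v + \<rho> * v"

definition root_of_inv :: "nat \<Rightarrow> real \<Rightarrow> real" where
  "root_of_inv C v = erlang_B (C - 1) v / (real C * v)"

lemma sum_exp_terms_eq:
  assumes "C \<ge> 1" "0 < u"
  shows "(\<Sum>m<C. u ^ m / fact m) = u ^ (C - 1) / fact (C - 1) * poly (erlang_poly (C - 1)) (1 / u)"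
proof -
  define N where "N = C - 1"
  have "(\<Sum>m<C. u ^ m / fact m) = (\<Sum>k\<le>N. u ^ (N - k) / fact (N - k))"
    using assms by (intro sum.reindex_bij_witness[of _ "\<lambda>k. N - k" "\<lambda>k. N - k"]) (auto simp: N_def)
  also have "\<dots> = (\<Sum>k\<le>N. u ^ N / fact N * (fact k * real (N choose k) * (1 / u) ^ k))"
  proof (rule sum.cong[OF refl])
    fix k assume "k \<in> {..N}"
    then have k: "k \<le> N" by simp
    have "u ^ N = u ^ (N - k) * u ^ k" using k by (simp flip: power_add)
    then show "u ^ (N - k) / fact (N - k) = u ^ N / fact N * (fact k * real (N choose k) * (1 / u) ^ k)"
      using \<open>0 < u\<close> by (simp add: binomial_fact[OF k] power_divide)
  qed
  finally show ?thesis
    by (simp add: N_def erlang_poly_def poly_sum poly_monom sum_distrib_left)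
qed

text \<open>With u = \<rho>1 + \<rho>2 z, \<Phi> is the positive factor u^N / N! times u / (C z) -
  Q(1 / u). The zero condition is left as a fixed-point equation, since u depends on z.\<close>

lemma Phi_eq_0_iff:
  assumes "C \<ge> 1" "0 < z" "0 < \<rho>1 + \<rho>2 * z"
  shows "Phi C \<rho>1 \<rho>2 z = 0 \<longleftrightarrow> z = root_of_inv C (1 / (\<rho>1 + \<rho>2 * z))"
proof -
  define u where "u = \<rho>1 + \<rho>2 * z"
  define Q where "Q = poly (erlang_poly (C - 1)) (1 / u)"
  have u: "0 < u" using assms by (simp add: u_def)
  have Q: "0 < Q" using poly_erlang_poly_ge_1[of "1 / u" "C - 1"] u by (simp add: Q_def)
  obtain N where N: "C = Suc N" using assms(1) by (cases C) auto
  have "1 / z * (u ^ C / fact C) = u ^ (C - 1) / fact (C - 1) * (u / (real C * z))"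
    using assms by (simp add: N divide_simps)
  then have "Phi C \<rho>1 \<rho>2 z = u ^ (C - 1) / fact (C - 1) * (u / (real C * z) - Q)"
    unfolding Phi_def u_def[symmetric] sum_exp_terms_eq[OF assms(1) u] Q_def[symmetric]
    by (simp only: right_diff_distrib)
  also have "\<dots> = 0 \<longleftrightarrow> u / (real C * z) = Q" using u by simp
  also have "\<dots> \<longleftrightarrow> z = root_of_inv C (1 / u)"
  proof -
    have "root_of_inv C (1 / u) = u / (real C * Q)"
      by (simp add: root_of_inv_def erlang_B_def Q_def)
    then show ?thesis using u Q assms by (auto simp: field_simps)
  qed
  finally show ?thesis by (simp add: u_def)
qed

text \<open>Inserting C v z = B(v) into v (\<rho>1 + \<rho>2 z) = 1 gives the equation for v;
  conversely a solution v returns z, and the same identity shows that v is the reciprocal load of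
  this z.\<close>

lemma Phi_roots_eq:
  assumes "C \<ge> 1" "0 < \<rho>1" "0 \<le> \<rho>2"
  shows "Phi_roots C \<rho>1 \<rho>2 = root_of_inv C ` {v. 0 < v \<and> root_fun (C - 1) \<rho>1 (\<rho>2 / real C) v = 1}"
proof (intro equalityI subsetI)
  fix z assume "z \<in> Phi_roots C \<rho>1 \<rho>2"
  then have z: "0 < z" "Phi C \<rho>1 \<rho>2 z = 0" by (auto simp: Phi_roots_def)
  define v where "v = 1 / (\<rho>1 + \<rho>2 * z)"
  have u: "0 < \<rho>1 + \<rho>2 * z" using assms z by (intro add_pos_nonneg) auto
  have v: "0 < v" using u by (simp add: v_def)
  have zv: "z = root_of_inv C v" using Phi_eq_0_iff[OF assms(1) z(1) u] z by (simp add: v_def)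
  have "erlang_B (C - 1) v = real C * v * z"
    using zv v assms by (simp add: root_of_inv_def)
  then have "root_fun (C - 1) \<rho>1 (\<rho>2 / real C) v = v * (\<rho>1 + \<rho>2 * z)"
    using assms by (simp add: root_fun_def algebra_simps)
  also have "\<dots> = 1" using u by (simp add: v_def)
  finally show "z \<in> root_of_inv C ` {v. 0 < v \<and> root_fun (C - 1) \<rho>1 (\<rho>2 / real C) v = 1}"
    using zv v by auto
next
  fix z assume "z \<in> root_of_inv C ` {v. 0 < v \<and> root_fun (C - 1) \<rho>1 (\<rho>2 / real C) v = 1}"
  then obtain v where v: "0 < v" "root_fun (C - 1) \<rho>1 (\<rho>2 / real C) v = 1" "z = root_of_inv C v"
    by auto
  have z: "0 < z" using v assms erlang_B_pos[of v "C - 1"] by (simp add: root_of_inv_def)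
  have u: "0 < \<rho>1 + \<rho>2 * z" using assms z by (intro add_pos_nonneg) auto
  have "erlang_B (C - 1) v = real C * v * z" using v assms by (simp add: root_of_inv_def)
  then have "v * (\<rho>1 + \<rho>2 * z) = 1"
    using v(2) assms by (simp add: root_fun_def algebra_simps)
  then have "1 / (\<rho>1 + \<rho>2 * z) = v" using u by (simp add: field_simps)
  then show "z \<in> Phi_roots C \<rho>1 \<rho>2"
    using Phi_eq_0_iff[OF assms(1) z u] v z by (simp add: Phi_roots_def)
qed

text \<open>The numerator decreases and the denominator increases. Hence roots may be counted in the
  variable v, and comparisons of v reverse for z.\<close>

lemma root_of_inv_strict_antimono:
  assumes "C \<ge> 2" "0 < v" "v < w"
  shows "root_of_inv C w < root_of_inv C v"
  unfolding root_of_inv_def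
  using assms erlang_B_strict_antimono[of "C - 1" v w] erlang_B_pos[of w "C - 1"]
  by (intro frac_less) auto

lemma inj_on_root_of_inv: "C \<ge> 2 \<Longrightarrow> inj_on (root_of_inv C) {0<..}"
  by (rule linorder_inj_onI') (use root_of_inv_strict_antimono in fastforce)

section \<open>Existence and uniqueness of solutions for s \<le> 1\<close>

lemma root_fun_strictly_convex:
  assumes "N \<ge> 1" "0 < s"
  shows "strictly_convex_on_ray (root_fun N \<rho> s)"
  unfolding strictly_convex_on_ray_def
proof (intro allI impI)
  fix a b c :: real assume abc: "0 \<le> a" "a < b" "b < c"
  have "s * ((c - a) * erlang_B N b) < s * ((c - b) * erlang_B N a + (b - a) * erlang_B N c)"
    using strictly_convex_on_rayD[OF strictly_convex_erlang_B[OF assms(1)] abc] assms by simp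
  then show "(c - a) * root_fun N \<rho> s b < (c - b) * root_fun N \<rho> s a + (b - a) * root_fun N \<rho> s c"
    by (simp add: root_fun_def algebra_simps)
qed

lemma continuous_on_root_fun: "continuous_on {0..} (root_fun N \<rho> s)"
  unfolding root_fun_def by (intro continuous_intros continuous_on_erlang_B)

lemma root_fun_0 [simp]: "root_fun N \<rho> s 0 = s"
  by (simp add: root_fun_def)

lemma root_fun_ge_1_at_inverse: "0 < \<rho> \<Longrightarrow> 0 \<le> s \<Longrightarrow> 1 \<le> root_fun N \<rho> s (1 / \<rho>)"
  using erlang_B_pos[of "1 / \<rho>" N] by (simp add: root_fun_def)

lemma root_fun_mono_strict: "0 \<le> v \<Longrightarrow> s < t \<Longrightarrow> root_fun N \<rho> s v < root_fun N \<rho> t v"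
  using erlang_B_pos[of v N] by (simp add: root_fun_def)

text \<open>The next two facts hold for \<open>s = 0\<close> as well, where strict convexity fails but
  \<^const>\<open>root_fun\<close> is linear.\<close>

lemma root_fun_less_1:
  assumes "N \<ge> 1" "0 < \<rho>" "0 \<le> s" "s \<le> 1" "root_fun N \<rho> s b = 1" "0 < x" "x < b"
  shows "root_fun N \<rho> s x < 1"
proof (cases "s = 0")
  case True
  have "\<rho> * x < \<rho> * b" using assms by simp
  then show ?thesis using assms(5) True by (simp add: root_fun_def)
next
  case False
  \<comment> \<open>The graph lies below the chord from (0, s) to (b, 1), whose height is at most 1
    because s \<le> 1.\<close>
  have "b * root_fun N \<rho> s x < (b - x) * s + x"
    using strictly_convex_on_rayD[OF root_fun_strictly_convex[of N s \<rho>], of 0 x b] assms False by simp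
  also have "\<dots> \<le> (b - x) * 1 + x" using assms by (intro add_right_mono mult_left_mono) auto
  finally have "b * root_fun N \<rho> s x < b * 1" by simp
  then show ?thesis using assms by (subst (asm) mult_less_cancel_left_pos) auto
qed

lemma root_fun_greater_1:
  assumes "N \<ge> 1" "0 < \<rho>" "0 \<le> s" "s \<le> 1" "root_fun N \<rho> s b = 1" "0 < b" "b < x"
  shows "1 < root_fun N \<rho> s x"
proof (cases "s = 0")
  case True
  have "\<rho> * b < \<rho> * x" using assms by simp
  then show ?thesis using assms(5) True by (simp add: root_fun_def)
next
  case False
  \<comment> \<open>Now b is the middle point: a value at most 1 at x would force a value below 1 at
    b.\<close>
  have "x < (x - b) * s + b * root_fun N \<rho> s x"
    using strictly_convex_on_rayD[OF root_fun_strictly_convex[of N s \<rho>], of 0 b x] assms False by simp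
  also have "\<dots> \<le> (x - b) * 1 + b * root_fun N \<rho> s x"
    using assms by (intro add_right_mono mult_left_mono) auto
  finally have "b * 1 < b * root_fun N \<rho> s x" by simp
  then show ?thesis using assms by (subst (asm) mult_less_cancel_left_pos) auto
qed

text \<open>At v = 1 / \<rho> the linear part alone equals 1, so the graph has climbed back to at
  least 1 there.\<close>

lemma root_fun_root_exists:
  assumes "0 < \<rho>" "0 \<le> s" "0 \<le> p" "root_fun N \<rho> s p < 1"
  obtains b where "p < b" "root_fun N \<rho> s b = 1"
proof -
  have p: "p \<le> 1 / \<rho>"
  proof (rule ccontr)
    assume "\<not> ?thesis"
    then have "1 \<le> \<rho> * p" using assms by (simp add: field_simps)
    then show False using assms erlang_B_pos[of p N]
      by (simp add: root_fun_def add_increasing leD)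
  qed
  have "\<exists>b\<ge>p. b \<le> 1 / \<rho> \<and> root_fun N \<rho> s b = 1"
  proof (rule IVT')
    show "continuous_on {p..1 / \<rho>} (root_fun N \<rho> s)"
      by (rule continuous_on_subset[OF continuous_on_root_fun]) (use assms in auto)
  qed (use assms root_fun_ge_1_at_inverse[of \<rho> s N] p in auto)
  then obtain b where b: "b \<ge> p" "root_fun N \<rho> s b = 1" by auto
  moreover from b assms have "b \<noteq> p" by auto
  ultimately show ?thesis using that[of b] by simp
qed

text \<open>The point p serves two cases: p = 0 when s < 1, and a point just right of 0 when s = 1,
  where the value at 0 is exactly 1.\<close>

lemma root_fun_unique_root:
  assumes "N \<ge> 1" "0 < \<rho>" "0 \<le> s" "s \<le> 1" "0 \<le> p" "root_fun N \<rho> s p < 1"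
  shows "\<exists>!v. 0 < v \<and> root_fun N \<rho> s v = 1"
proof -
  obtain b where b: "0 < b" "root_fun N \<rho> s b = 1"
    using root_fun_root_exists[of \<rho> s p N] assms by (metis le_less_trans)
  show ?thesis
  proof (rule ex1I[of _ b])
    fix v assume "0 < v \<and> root_fun N \<rho> s v = 1"
    then show "v = b"
      using root_fun_less_1[of N \<rho> s b v] root_fun_less_1[of N \<rho> s v b] assms b
      by (cases v b rule: linorder_cases) auto
  qed (use b in auto)
qed

lemma root_fun_critical_gt_1:
  assumes "N \<ge> 1" "real N \<le> \<rho>" "0 < v"
  shows "1 < root_fun N \<rho> 1 v"
proof -
  have "1 - \<rho> * v \<le> 1 - real N * v" using assms by simp
  then show ?thesis using erlang_B_above_tangent[OF assms(1,3)] by (simp add: root_fun_def)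
qed

section \<open>The solution for s < 1 and its dependence on s\<close>

definition inv_root :: "nat \<Rightarrow> real \<Rightarrow> real \<Rightarrow> real" where
  "inv_root N \<rho> s = (THE v. 0 < v \<and> root_fun N \<rho> s v = 1)"

lemma inv_root:
  assumes "N \<ge> 1" "0 < \<rho>" "0 \<le> s" "s < 1"
  shows "0 < inv_root N \<rho> s" "root_fun N \<rho> s (inv_root N \<rho> s) = 1"
  using theI'[OF root_fun_unique_root[of N \<rho> s 0]] assms by (auto simp: inv_root_def)

text \<open>This sign test at a single point, together with the next one, takes the place of an
  implicit function theorem: monotonicity and limits in s both follow from it.\<close>

lemma inv_root_greater:
  assumes "N \<ge> 1" "0 < \<rho>" "0 \<le> s" "s < 1" "0 \<le> w" "root_fun N \<rho> s w < 1"
  shows "w < inv_root N \<rho> s"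
  using root_fun_greater_1[of N \<rho> s "inv_root N \<rho> s" w] inv_root[of N \<rho> s] assms
  by (cases w "inv_root N \<rho> s" rule: linorder_cases) auto

lemma inv_root_less:
  assumes "N \<ge> 1" "0 < \<rho>" "0 \<le> s" "s < 1" "0 < w" "1 < root_fun N \<rho> s w"
  shows "inv_root N \<rho> s < w"
  using root_fun_less_1[of N \<rho> s "inv_root N \<rho> s" w] inv_root[of N \<rho> s] assms
  by (cases w "inv_root N \<rho> s" rule: linorder_cases) auto

lemma Phi_roots_subcritical:
  assumes "C \<ge> 2" "0 < \<rho>1" "0 \<le> \<rho>2" "\<rho>2 < real C"
  shows "Phi_roots C \<rho>1 \<rho>2 = {root_of_inv C (inv_root (C - 1) \<rho>1 (\<rho>2 / real C))}"
proof -
  let ?s = "\<rho>2 / real C"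
  have s: "0 \<le> ?s" "?s < 1" using assms by auto
  have "{v. 0 < v \<and> root_fun (C - 1) \<rho>1 ?s v = 1} = {inv_root (C - 1) \<rho>1 ?s}"
  proof -
    have "C - 1 \<ge> 1" using assms by simp
    then show ?thesis
      using root_fun_unique_root[of "C - 1" \<rho>1 ?s 0] inv_root[of "C - 1" \<rho>1 ?s] s assms(2)
      by (auto simp del: One_nat_def)
  qed
  then show ?thesis using assms by (subst Phi_roots_eq) auto
qed

lemma zroot_eq:
  assumes "C \<ge> 2" "0 < \<rho>1" "0 \<le> \<rho>2" "\<rho>2 < real C"
  shows "zroot C \<rho>1 \<rho>2 = root_of_inv C (inv_root (C - 1) \<rho>1 (\<rho>2 / real C))"
  by (simp add: zroot_def Phi_roots_subcritical[OF assms])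

text \<open>Raising \<rho>2 lifts \<open>root_fun\<close> above 1 at the old solution, so v moves
  left and z moves right.\<close>

lemma strict_mono_on_zroot:
  assumes "C \<ge> 2" "0 < \<rho>1"
  shows "strict_mono_on {0<..<real C} (zroot C \<rho>1)"
proof (rule strict_mono_onI)
  fix r t assume "r \<in> {0<..<real C}" "t \<in> {0<..<real C}" "r < t"
  then have rt: "0 < r" "r < t" "t < real C" by auto
  let ?v = "inv_root (C - 1) \<rho>1"
  have v: "0 < ?v (r / real C)" "root_fun (C - 1) \<rho>1 (r / real C) (?v (r / real C)) = 1"
    using inv_root[of "C - 1" \<rho>1 "r / real C"] rt assms by auto
  have "r / real C < t / real C" using rt by (simp add: divide_strict_right_mono)
  then have "?v (t / real C) < ?v (r / real C)"
    using v rt assms root_fun_mono_strict[of "?v (r / real C)" "r / real C" "t / real C" "C - 1" \<rho>1]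
    by (intro inv_root_less) auto
  then show "zroot C \<rho>1 r < zroot C \<rho>1 t"
    using rt assms inv_root(1)[of "C - 1" \<rho>1 "t / real C"]
    by (subst (1 2) zroot_eq) (auto intro!: root_of_inv_strict_antimono)
qed

section \<open>The limit as \<rho>2 increases to C\<close>

lemma tendsto_root_fun:
  "((\<lambda>\<rho>2. root_fun N \<rho> (\<rho>2 / c) v) \<longlongrightarrow> root_fun N \<rho> (a / c) v) (at a within A)"
  if "c \<noteq> 0"
  unfolding root_fun_def using that by (intro tendsto_intros)

text \<open>At a fixed w the value of \<open>root_fun\<close> is continuous in \<rho>2, so the
  strict inequality at \<rho>2 = C persists slightly to the left, where the sign test
  applies.\<close>

lemma eventually_inv_root_less:
  assumes "C \<ge> 2" "0 < \<rho>" "0 < w" "1 < root_fun (C - 1) \<rho> 1 w"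
  shows "eventually (\<lambda>\<rho>2. inv_root (C - 1) \<rho> (\<rho>2 / real C) < w) (at_left (real C))"
proof -
  have "eventually (\<lambda>\<rho>2. 1 < root_fun (C - 1) \<rho> (\<rho>2 / real C) w) (at_left (real C))"
    using order_tendstoD(1)[OF tendsto_root_fun[of "real C" "C - 1" \<rho> w "real C"]] assms by simp
  moreover have "eventually (\<lambda>\<rho>2. \<rho>2 \<in> {0<..<real C}) (at_left (real C))"
    using assms by (intro eventually_at_left_real) auto
  ultimately show ?thesis
    by eventually_elim (use assms in \<open>auto intro!: inv_root_less\<close>)
qed

lemma eventually_inv_root_greater:
  assumes "C \<ge> 2" "0 < \<rho>" "0 < w" "root_fun (C - 1) \<rho> 1 w < 1"
  shows "eventually (\<lambda>\<rho>2. w < inv_root (C - 1) \<rho> (\<rho>2 / real C)) (at_left (real C))"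
proof -
  have "eventually (\<lambda>\<rho>2. root_fun (C - 1) \<rho> (\<rho>2 / real C) w < 1) (at_left (real C))"
    using order_tendstoD(2)[OF tendsto_root_fun[of "real C" "C - 1" \<rho> w "real C"]] assms by simp
  moreover have "eventually (\<lambda>\<rho>2. \<rho>2 \<in> {0<..<real C}) (at_left (real C))"
    using assms by (intro eventually_at_left_real) auto
  ultimately show ?thesis
    by eventually_elim (use assms in \<open>auto intro!: inv_root_greater\<close>)
qed

lemma eventually_zroot_eq:
  assumes "C \<ge> 2" "0 < \<rho>"
  shows "eventually (\<lambda>\<rho>2. root_of_inv C (inv_root (C - 1) \<rho> (\<rho>2 / real C)) = zroot C \<rho> \<rho>2) (at_left (real C))"
proof -
  have "eventually (\<lambda>\<rho>2. \<rho>2 \<in> {0<..<real C}) (at_left (real C))"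
    using assms by (intro eventually_at_left_real) auto
  then show ?thesis by eventually_elim (use assms zroot_eq in auto)
qed

lemma continuous_root_of_inv:
  assumes "C \<ge> 1" "0 < v"
  shows "isCont (root_of_inv C) v"
  using assms DERIV_isCont[OF DERIV_erlang_B, of v "C - 1"]
  unfolding root_of_inv_def[abs_def] by (intro continuous_intros) auto

lemma Phi_roots_critical:
  assumes "C \<ge> 2" "0 < \<rho>" "\<rho> < real C - 1"
  obtains z where "Phi_roots C \<rho> (real C) = {z}" "0 < z" "(zroot C \<rho> \<longlongrightarrow> z) (at_left (real C))"
proof -
  obtain p where p: "0 < p" "root_fun (C - 1) \<rho> 1 p < 1"
    using erlang_B_below_line[of \<rho> "C - 1"] assms unfolding root_fun_def by (auto simp: of_nat_diff)
  have ex1: "\<exists>!v. 0 < v \<and> root_fun (C - 1) \<rho> 1 v = 1"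
    using root_fun_unique_root[of "C - 1" \<rho> 1 p] p assms by auto
  then obtain v where v: "0 < v" "root_fun (C - 1) \<rho> 1 v = 1" by auto
  with ex1 have "{v. 0 < v \<and> root_fun (C - 1) \<rho> 1 v = 1} = {v}" by auto
  then have roots: "Phi_roots C \<rho> (real C) = {root_of_inv C v}"
    using assms by (subst Phi_roots_eq) auto
  have pos: "0 < root_of_inv C v"
    using v assms erlang_B_pos[of v "C - 1"] by (simp add: root_of_inv_def)
  have "((\<lambda>\<rho>2. inv_root (C - 1) \<rho> (\<rho>2 / real C)) \<longlongrightarrow> v) (at_left (real C))"
  proof (rule order_tendstoI)
    fix a assume "a < v"
    \<comment> \<open>The test point has to be positive and below v, hence the maximum with v /
      2.\<close>
    then have "eventually (\<lambda>\<rho>2. max a (v / 2) < inv_root (C - 1) \<rho> (\<rho>2 / real C)) (at_left (real C))"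
      using v assms by (intro eventually_inv_root_greater root_fun_less_1[of _ _ _ v]) auto
    then show "eventually (\<lambda>\<rho>2. a < inv_root (C - 1) \<rho> (\<rho>2 / real C)) (at_left (real C))"
      by eventually_elim simp
  next
    fix a assume "v < a"
    then show "eventually (\<lambda>\<rho>2. inv_root (C - 1) \<rho> (\<rho>2 / real C) < a) (at_left (real C))"
      using v assms by (intro eventually_inv_root_less root_fun_greater_1[of _ _ _ v]) auto
  qed
  then have "((\<lambda>\<rho>2. root_of_inv C (inv_root (C - 1) \<rho> (\<rho>2 / real C))) \<longlongrightarrow> root_of_inv C v) (at_left (real C))"
    using v assms by (intro isCont_tendsto_compose[OF continuous_root_of_inv]) auto
  then have "(zroot C \<rho> \<longlongrightarrow> root_of_inv C v) (at_left (real C))"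
    by (rule Lim_transform_eventually) (use eventually_zroot_eq assms in auto)
  then show ?thesis using that roots pos by blast
qed

text \<open>For \<rho> \<ge> C - 1 the critical function exceeds 1 at every positive v by the
  tangent bound. The solution v is therefore pushed to 0, and z = B(v) / (C v) blows up.\<close>

lemma filterlim_zroot_at_top:
  assumes "C \<ge> 2" "real C - 1 \<le> \<rho>"
  shows "filterlim (zroot C \<rho>) at_top (at_left (real C))"
proof (rule filterlim_at_top_gt[where c = 0, THEN iffD2], intro allI impI)
  have \<rho>: "0 < \<rho>" using assms by linarith
  fix Z :: real assume "0 < Z"
  define B where "B = erlang_B (C - 1) 1"
  have B: "0 < B" unfolding B_def by (rule erlang_B_pos) simp
  \<comment> \<open>The bound w \<le> 1 gives B(w) \<ge> B(1), and then w \<le> B(1) / (C Z) makes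
    the quotient \<open>root_of_inv C w\<close> at least Z.\<close>
  define w where "w = min 1 (B / (real C * Z))"
  have w: "0 < w" "w \<le> 1" "w \<le> B / (real C * Z)" using B \<open>0 < Z\<close> assms by (auto simp: w_def)
  have "B \<le> erlang_B (C - 1) w"
    using erlang_B_strict_antimono[of "C - 1" w 1] w assms
    by (cases "w = 1") (auto simp: B_def less_imp_le)
  moreover have "real C * w * Z \<le> B" using w \<open>0 < Z\<close> assms by (simp add: field_simps)
  ultimately have Z: "Z \<le> root_of_inv C w"
    using w assms by (simp add: root_of_inv_def field_simps)
  have "eventually (\<lambda>\<rho>2. inv_root (C - 1) \<rho> (\<rho>2 / real C) < w) (at_left (real C))"
    using assms w \<rho> by (intro eventually_inv_root_less root_fun_critical_gt_1) (auto simp: of_nat_diff)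
  moreover have "eventually (\<lambda>\<rho>2. \<rho>2 \<in> {0<..<real C}) (at_left (real C))"
    using assms by (intro eventually_at_left_real) auto
  ultimately show "eventually (\<lambda>\<rho>2. Z \<le> zroot C \<rho> \<rho>2) (at_left (real C))"
  proof eventually_elim
    case (elim t)
    have "root_of_inv C w < root_of_inv C (inv_root (C - 1) \<rho> (t / real C))"
      using elim assms \<rho> inv_root(1)[of "C - 1" \<rho> "t / real C"]
      by (intro root_of_inv_strict_antimono) auto
    then show ?case using Z zroot_eq[of C \<rho> t] elim assms \<rho> by simp
  qed
qed

text \<open>\<open>Lim\<close> is a definite description, so its value can be read off only after
  convergence has been proved.\<close>

lemma zroot_limit_eq:
  assumes "((\<lambda>\<rho>2. ereal (zroot C \<rho>1 \<rho>2)) \<longlongrightarrow> l) (at_left (real C))"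
  shows "zroot_limit C \<rho>1 = l"
  unfolding zroot_limit_def by (rule tendsto_Lim[OF _ assms]) simp

section \<open>The threshold: the equation solved for \<rho> and maximised over v\<close>

definition load_gap :: "nat \<Rightarrow> real \<Rightarrow> real \<Rightarrow> real" where
  "load_gap N s v = (1 - s * erlang_B N v) / v"

lemma root_fun_vs_load_gap:
  assumes "0 < v"
  shows "root_fun N \<rho> s v < 1 \<longleftrightarrow> \<rho> < load_gap N s v"
    and "root_fun N \<rho> s v = 1 \<longleftrightarrow> \<rho> = load_gap N s v"
  using assms by (auto simp: root_fun_def load_gap_def field_simps)

lemma load_gap_mono:
  assumes "0 < v" "s \<le> t"
  shows "load_gap N t v \<le> load_gap N s v"
  unfolding load_gap_def using assms erlang_B_pos[of v N]
  by (intro divide_right_mono diff_left_mono mult_right_mono) auto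

lemma load_gap_less_N:
  assumes "N \<ge> 1" "0 < v" "1 \<le> s"
  shows "load_gap N s v < real N"
proof -
  have "load_gap N s v \<le> load_gap N 1 v" using assms by (intro load_gap_mono) auto
  also have "\<dots> < real N"
    using erlang_B_above_tangent[OF assms(1,2)] assms by (simp add: load_gap_def field_simps)
  finally show ?thesis .
qed

lemma load_gap_less_inverse:
  assumes "0 < v" "0 < s"
  shows "load_gap N s v < 1 / v"
  using assms erlang_B_pos[of v N] by (simp add: load_gap_def divide_strict_right_mono)

lemma load_gap_pos_exists:
  assumes "N \<ge> 1" "0 < s"
  obtains v where "0 < v" "0 < load_gap N s v"
\<comment> \<open>At v = s / N the bound 1 / (1 + N v) becomes 1 / (1 + s), and s / (1 + s) <
  1.\<close>
proof (rule that[of "s / real N"])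
  show v: "0 < s / real N" using assms by simp
  have "erlang_B N (s / real N) \<le> 1 / (1 + s)"
    using erlang_B_upper[of "s / real N" N] assms by simp
  then have "s * erlang_B N (s / real N) \<le> s * (1 / (1 + s))"
    using assms by (intro mult_left_mono) auto
  also have "\<dots> < 1" using assms by simp
  finally show "0 < load_gap N s (s / real N)" unfolding load_gap_def
    using v assms by (intro divide_pos_pos) simp_all
qed

lemma load_gap_attains_max:
  assumes "N \<ge> 1" "1 < s"
  obtains v where "0 < v" "0 < load_gap N s v" "\<And>w. 0 < w \<Longrightarrow> load_gap N s w \<le> load_gap N s v"
proof -
  obtain p where p: "0 < p" "0 < load_gap N s p" using load_gap_pos_exists[of N s] assms by auto
  have "isCont (erlang_B N) 0" by (rule DERIV_isCont[OF DERIV_erlang_B_0])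
  then have "isCont (\<lambda>v. s * erlang_B N v) 0" by (intro continuous_intros)
  then have "((\<lambda>v. s * erlang_B N v) \<longlongrightarrow> s) (at 0)" by (simp add: isCont_def)
  from order_tendstoD(1)[OF this assms(2)] obtain d where
    d: "0 < d" "\<And>v. v \<noteq> 0 \<Longrightarrow> dist v 0 < d \<Longrightarrow> 1 < s * erlang_B N v"
    by (auto simp: eventually_at)
  have small: "load_gap N s v < 0" if "0 < v" "v < d" for v
    using d(2)[of v] that by (simp add: load_gap_def divide_neg_pos)
  \<comment> \<open>A maximum over the compact interval from a to b is global: left of a the gap is
    negative since s > 1, and right of b it is below 1 / w, hence below its value at p.\<close>
  define a where "a = min d p"
  define b where "b = max p (1 / load_gap N s p)"
  have ab: "0 < a" "a \<le> p" "p \<le> b" using d p by (auto simp: a_def b_def)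
  have "continuous_on {a..b} (load_gap N s)"
    unfolding load_gap_def[abs_def] using ab
    by (intro continuous_intros continuous_on_subset[OF continuous_on_erlang_B]) auto
  then obtain v where v: "v \<in> {a..b}" "\<And>w. w \<in> {a..b} \<Longrightarrow> load_gap N s w \<le> load_gap N s v"
    using continuous_attains_sup[of "{a..b}" "load_gap N s"] ab by auto
  have vp: "load_gap N s p \<le> load_gap N s v" using v(2)[of p] ab by simp
  show ?thesis
  proof (rule that[of v])
    show "0 < v" using v ab by simp
    show "0 < load_gap N s v" using vp p by simp
    fix w :: real assume w: "0 < w"
    consider "w < a" | "w \<in> {a..b}" | "b < w" by fastforce
    then show "load_gap N s w \<le> load_gap N s v"
    proof cases
      case 1
      then show ?thesis using small[of w] w vp p by (simp add: a_def)
    next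
      case 2
      then show ?thesis by (rule v(2))
    next
      case 3
      then have "1 / load_gap N s p < w" by (simp add: b_def)
      then have "1 / w < load_gap N s p" using p w by (simp add: field_simps)
      then show ?thesis using load_gap_less_inverse[OF w, of s N] assms vp by simp
    qed
  qed
qed

text \<open>Any maximiser serves, since only the maximal value enters
  \<open>phi_bound\<close>.\<close>

definition phi_arg :: "nat \<Rightarrow> real \<Rightarrow> real" where
  "phi_arg N s = (SOME v. 0 < v \<and> 0 < load_gap N s v \<and>
     (\<forall>w>0. load_gap N s w \<le> load_gap N s v))"

lemma phi_arg:
  assumes "N \<ge> 1" "1 < s"
  shows "0 < phi_arg N s" "0 < load_gap N s (phi_arg N s)"
    and "0 < w \<Longrightarrow> load_gap N s w \<le> load_gap N s (phi_arg N s)"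
proof -
  have "\<exists>v. 0 < v \<and> 0 < load_gap N s v \<and> (\<forall>w>0. load_gap N s w \<le> load_gap N s v)"
    using load_gap_attains_max[OF assms] by metis
  from someI_ex[OF this]
  show "0 < phi_arg N s" "0 < load_gap N s (phi_arg N s)"
    and "0 < w \<Longrightarrow> load_gap N s w \<le> load_gap N s (phi_arg N s)"
    unfolding phi_arg_def by auto
qed

definition phi_bound :: "nat \<Rightarrow> real \<Rightarrow> real" where
  "phi_bound C \<rho>2 = load_gap (C - 1) (\<rho>2 / real C) (phi_arg (C - 1) (\<rho>2 / real C))"

lemma phi_bound_range:
  assumes "C \<ge> 2" "real C < \<rho>2"
  shows "0 < phi_bound C \<rho>2" "phi_bound C \<rho>2 < real C - 1"
  using assms phi_arg[of "C - 1" "\<rho>2 / real C"]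
    load_gap_less_N[of "C - 1" "phi_arg (C - 1) (\<rho>2 / real C)" "\<rho>2 / real C"]
  by (auto simp: phi_bound_def of_nat_diff)

lemma phi_bound_upper:
  assumes "C \<ge> 2" "real C < \<rho>2" "0 < v"
  shows "load_gap (C - 1) (\<rho>2 / real C) v \<le> phi_bound C \<rho>2"
  using assms phi_arg(3)[of "C - 1" "\<rho>2 / real C" v] by (simp add: phi_bound_def)

text \<open>The gap decreases pointwise in s; compare at the maximiser belonging to the larger
  \<rho>2.\<close>

lemma antimono_on_phi_bound:
  assumes "C \<ge> 2"
  shows "antimono_on {real C<..} (phi_bound C)"
proof (rule monotone_onI)
  fix r t assume "r \<in> {real C<..}" "t \<in> {real C<..}" and rt: "r \<le> t"
  then have r: "real C < r" and t: "real C < t" by auto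
  have v: "0 < phi_arg (C - 1) (t / real C)" using assms t by (intro phi_arg) auto
  have "phi_bound C t \<le> load_gap (C - 1) (r / real C) (phi_arg (C - 1) (t / real C))"
    unfolding phi_bound_def using v rt by (intro load_gap_mono divide_right_mono) auto
  also have "\<dots> \<le> phi_bound C r" using assms r v by (rule phi_bound_upper)
  finally show "phi_bound C t \<le> phi_bound C r" .
qed

text \<open>A positive gap requires s B(v) < 1, which fails for all v \<le> 1 / e once s B(1 / e) >
  1. So the maximiser exceeds 1 / e, and the gap there is below 1 / v < e.\<close>

lemma phi_bound_at_top:
  assumes "C \<ge> 2"
  shows "(phi_bound C \<longlongrightarrow> 0) at_top"
proof (rule order_tendstoI)
  fix a :: real assume "a < 0"
  show "eventually (\<lambda>x. a < phi_bound C x) at_top"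
    using eventually_gt_at_top[of "real C"]
    by eventually_elim (use phi_bound_range(1)[OF assms] \<open>a < 0\<close> in force)
next
  fix e :: real assume e: "0 < e"
  define B where "B = erlang_B (C - 1) (1 / e)"
  have B: "0 < B" unfolding B_def using e by (intro erlang_B_pos) simp
  show "eventually (\<lambda>x. phi_bound C x < e) at_top"
    using eventually_gt_at_top[of "real C"] eventually_gt_at_top[of "real C / B"]
  proof eventually_elim
    case (elim x)
    let ?v = "phi_arg (C - 1) (x / real C)"
    have v: "0 < ?v" "0 < load_gap (C - 1) (x / real C) ?v"
      using assms elim by (auto intro!: phi_arg)
    have x: "1 < x / real C * B" using elim B assms by (simp add: field_simps)
    have xpos: "0 < x / real C" using elim assms by (simp add: order_less_trans[of 0 "real C"])
    have "1 / e < ?v"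
    proof (rule ccontr)
      assume "\<not> ?thesis"
      then have "B \<le> erlang_B (C - 1) ?v"
        using erlang_B_strict_antimono[of "C - 1" ?v "1 / e"] v assms
        by (cases "?v = 1 / e") (auto simp: B_def intro: less_imp_le)
      then have "x / real C * B \<le> x / real C * erlang_B (C - 1) ?v"
        using xpos by (intro mult_left_mono) auto
      with x v show False by (simp add: load_gap_def zero_less_divide_iff)
    qed
    then have "1 / ?v < e" using e v by (simp add: field_simps)
    then show ?case
      using load_gap_less_inverse[of ?v "x / real C" "C - 1"] v xpos by (simp add: phi_bound_def)
  qed
qed

text \<open>The upper estimate is the range of the threshold. For the lower one, fix a v whose gap
  at s = 1 exceeds a; by continuity in s the gap at this v stays above a, and the maximum dominates
  it.\<close>

lemma phi_bound_at_right:
  assumes "C \<ge> 2"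
  shows "(phi_bound C \<longlongrightarrow> real C - 1) (at_right (real C))"
proof (rule order_tendstoI)
  fix a assume a: "a < real C - 1"
  obtain v where v: "0 < v" "erlang_B (C - 1) v + a * v < 1"
    using erlang_B_below_line[of a "C - 1"] a assms by (auto simp: of_nat_diff)
  have "a < load_gap (C - 1) (real C / real C) v"
    using v assms by (simp add: load_gap_def field_simps)
  moreover have "((\<lambda>x. load_gap (C - 1) (x / real C) v) \<longlongrightarrow> load_gap (C - 1) (real C / real C) v) (at_right (real C))"
    unfolding load_gap_def using v assms by (intro tendsto_intros) auto
  ultimately have "eventually (\<lambda>x. a < load_gap (C - 1) (x / real C) v) (at_right (real C))"
    by (rule order_tendstoD(1)[rotated])
  then show "eventually (\<lambda>x. a < phi_bound C x) (at_right (real C))"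
    using eventually_at_right_less[of "real C"]
    by eventually_elim (use phi_bound_upper[OF assms] v in \<open>force intro: less_le_trans\<close>)
next
  fix a assume "real C - 1 < a"
  then show "eventually (\<lambda>x. phi_bound C x < a) (at_right (real C))"
    using eventually_at_right_less[of "real C"]
    by (auto elim!: eventually_mono intro: less_trans[OF phi_bound_range(2)[OF assms]])
qed

section \<open>Counting roots for \<rho>2 > C\<close>

lemma root_fun_no_three_roots:
  assumes "N \<ge> 1" "0 < s" "0 < a" "a < b" "b < c"
    and "root_fun N \<rho> s a = 1" "root_fun N \<rho> s b = 1" "root_fun N \<rho> s c = 1"
  shows False
  using strictly_convex_on_rayD[OF root_fun_strictly_convex[OF assms(1,2)], of a b c \<rho>] assms
  by simp

text \<open>The graph starts at s > 1, is below 1 at the maximiser p, and returns to 1 later, giving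
  one solution on each side of p; strict convexity excludes a third.\<close>

lemma card_Phi_roots_2:
  assumes "C \<ge> 2" "0 < \<rho>1" "real C < \<rho>2" "\<rho>1 < phi_bound C \<rho>2"
  shows "card (Phi_roots C \<rho>1 \<rho>2) = 2"
proof -
  define N where "N = C - 1"
  define s where "s = \<rho>2 / real C"
  define p where "p = phi_arg N s"
  have N: "N \<ge> 1" and s: "1 < s" using assms by (auto simp: N_def s_def)
  have p: "0 < p" unfolding p_def by (rule phi_arg[OF N s])
  have Kp: "root_fun N \<rho>1 s p < 1"
    using assms(4) p root_fun_vs_load_gap(1)[OF p]
    by (simp add: phi_bound_def p_def N_def s_def)
  obtain b where b: "p < b" "root_fun N \<rho>1 s b = 1"
    using root_fun_root_exists[of \<rho>1 s p N] assms(2) s p Kp by auto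
  have "\<exists>a\<ge>0. a \<le> p \<and> root_fun N \<rho>1 s a = 1"
  proof (rule IVT2')
    show "continuous_on {0..p} (root_fun N \<rho>1 s)"
      by (rule continuous_on_subset[OF continuous_on_root_fun]) auto
  qed (use s p Kp in auto)
  then obtain a where a: "0 \<le> a" "a \<le> p" "root_fun N \<rho>1 s a = 1" by auto
  with s Kp have a': "0 < a" "a < p" by (auto simp: order_less_le)
  have "{v. 0 < v \<and> root_fun N \<rho>1 s v = 1} = {a, b}"
  proof (intro equalityI subsetI)
    fix v assume "v \<in> {v. 0 < v \<and> root_fun N \<rho>1 s v = 1}"
    then have v: "0 < v" "root_fun N \<rho>1 s v = 1" by auto
    consider "v < a" | "v = a" | "a < v" "v < b" | "v = b" | "b < v" by linarith
    then show "v \<in> {a, b}"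
    proof cases
      case 1
      then show ?thesis using root_fun_no_three_roots[of N s v a b \<rho>1] N s v a a' b by simp
    next
      case 3
      then show ?thesis using root_fun_no_three_roots[of N s a v b \<rho>1] N s v a a' b by simp
    next
      case 5
      then show ?thesis using root_fun_no_three_roots[of N s a b v \<rho>1] N s v a a' b by simp
    qed auto
  qed (use a a' b p in auto)
  then have "Phi_roots C \<rho>1 \<rho>2 = root_of_inv C ` {a, b}"
    using assms by (subst Phi_roots_eq) (auto simp: N_def s_def)
  moreover have "inj_on (root_of_inv C) {a, b}"
    by (rule inj_on_subset[OF inj_on_root_of_inv[OF assms(1)]]) (use a' b p in auto)
  moreover have "card {a, b} = 2" using a' b by simp
  ultimately show ?thesis by (simp only: card_image)
qed

lemma Phi_roots_empty:
  assumes "C \<ge> 2" "0 < \<rho>1" "real C < \<rho>2" "phi_bound C \<rho>2 < \<rho>1"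
  shows "Phi_roots C \<rho>1 \<rho>2 = {}"
proof -
  have "root_fun (C - 1) \<rho>1 (\<rho>2 / real C) v \<noteq> 1" if "0 < v" for v
    using root_fun_vs_load_gap(2)[OF that, of "C - 1" \<rho>1 "\<rho>2 / real C"]
      phi_bound_upper[OF assms(1,3) that] assms(4) by auto
  then show ?thesis using assms by (subst Phi_roots_eq) auto
qed

text \<open>Between two maximisers of \<^const>\<open>load_gap\<close> strict convexity would give a larger value.\<close>

lemma Phi_roots_singleton:
  assumes "C \<ge> 2" "real C < \<rho>2"
  shows "\<exists>!z. z \<in> Phi_roots C (phi_bound C \<rho>2) \<rho>2"
proof -
  define N where "N = C - 1"
  define s where "s = \<rho>2 / real C"
  define \<rho> where "\<rho> = phi_bound C \<rho>2"
  define p where "p = phi_arg N s"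
  have N: "N \<ge> 1" and s: "1 < s" using assms by (auto simp: N_def s_def)
  have \<rho>: "0 < \<rho>" unfolding \<rho>_def by (rule phi_bound_range[OF assms])
  have p: "0 < p" unfolding p_def by (rule phi_arg[OF N s])
  have Kp: "root_fun N \<rho> s p = 1"
    using root_fun_vs_load_gap(2)[OF p] by (simp add: \<rho>_def phi_bound_def p_def N_def s_def)
  have ge1: "1 \<le> root_fun N \<rho> s w" if "0 < w" for w
    using root_fun_vs_load_gap(1)[OF that, of N \<rho> s] phi_bound_upper[OF assms that]
    by (simp add: \<rho>_def N_def s_def not_less[symmetric])
  have no_two: False if "0 < a" "a < b" "root_fun N \<rho> s a = 1" "root_fun N \<rho> s b = 1" for a b
  proof -
    \<comment> \<open>The midpoint of two solutions would have a value below 1, while maximality of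
      the threshold, in the form \<open>ge1\<close>, makes 1 the minimum.\<close>
    let ?m = "(a + b) / 2"
    have "(b - a) * root_fun N \<rho> s ?m < (b - ?m) + (?m - a)"
      using strictly_convex_on_rayD[OF root_fun_strictly_convex[OF N, of s \<rho>], of a ?m b] s that
      by simp
    also have "(b - ?m) + (?m - a) = (b - a) * 1" by (simp only: mult_1_right diff_add_cancel add_diff_eq)
    finally have "(b - a) * root_fun N \<rho> s ?m < (b - a) * 1" .
    then have "root_fun N \<rho> s ?m < 1" using that by (subst (asm) mult_less_cancel_left_pos) auto
    then show False using ge1[of ?m] that by simp
  qed
  have "{v. 0 < v \<and> root_fun N \<rho> s v = 1} = {p}"
  proof (intro equalityI subsetI)
    fix v assume "v \<in> {v. 0 < v \<and> root_fun N \<rho> s v = 1}"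
    then show "v \<in> {p}" using no_two[of v p] no_two[of p v] p Kp by (cases v p rule: linorder_cases) auto
  qed (use p Kp in auto)
  then have "Phi_roots C \<rho> \<rho>2 = {root_of_inv C p}"
    using assms \<rho> by (subst Phi_roots_eq) (auto simp: N_def s_def)
  then show ?thesis by (simp add: \<rho>_def)
qed

theorem proposition2p3:
  fixes C :: nat
  assumes "C \<ge> 2"
  shows "(\<forall>\<rho>1::real. 0 < \<rho>1 \<and> \<rho>1 < real C \<longrightarrow>
            (\<forall>\<rho>2\<in>{0..<real C}. \<exists>!z. z \<in> Phi_roots C \<rho>1 \<rho>2) \<and>
            strict_mono_on {0<..<real C} (zroot C \<rho>1) \<and>
            ((\<lambda>\<rho>2. ereal (zroot C \<rho>1 \<rho>2)) \<longlongrightarrow> zroot_limit C \<rho>1) (at_left (real C)) \<and>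
            0 < zroot_limit C \<rho>1 \<and>
            (\<rho>1 < real C - 1 \<longrightarrow>
               (\<exists>!z. z \<in> Phi_roots C \<rho>1 (real C)) \<and>
               (\<exists>z\<in>Phi_roots C \<rho>1 (real C). zroot_limit C \<rho>1 = ereal z)) \<and>
            (\<rho>1 \<ge> real C - 1 \<longrightarrow> zroot_limit C \<rho>1 = \<infinity>)) \<and>
         (\<exists>\<phi> :: real \<Rightarrow> real.
            \<phi> \<in> {real C<..} \<rightarrow> {0<..<real C - 1} \<and>
            antimono_on {real C<..} \<phi> \<and>
            (\<phi> \<longlongrightarrow> 0) at_top \<and>
            (\<phi> \<longlongrightarrow> real C - 1) (at_right (real C)) \<and>
            (\<forall>\<rho>1 \<rho>2. 0 < \<rho>1 \<and> \<rho>1 < real C \<and> real C < \<rho>2 \<longrightarrow>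
               (\<rho>1 < \<phi> \<rho>2 \<longrightarrow> card (Phi_roots C \<rho>1 \<rho>2) = 2) \<and>
               (\<phi> \<rho>2 < \<rho>1 \<longrightarrow> Phi_roots C \<rho>1 \<rho>2 = {}) \<and>
               (\<rho>1 = \<phi> \<rho>2 \<longrightarrow> (\<exists>!z. z \<in> Phi_roots C \<rho>1 \<rho>2))))"
proof (intro conjI allI impI)
  fix \<rho>1 :: real assume "0 < \<rho>1 \<and> \<rho>1 < real C"
  then have \<rho>1: "0 < \<rho>1" by simp
  show "\<forall>\<rho>2\<in>{0..<real C}. \<exists>!z. z \<in> Phi_roots C \<rho>1 \<rho>2"
    using Phi_roots_subcritical[OF assms \<rho>1] by auto
  show "strict_mono_on {0<..<real C} (zroot C \<rho>1)"
    using assms \<rho>1 by (rule strict_mono_on_zroot)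
  have sub: "((\<lambda>\<rho>2. ereal (zroot C \<rho>1 \<rho>2)) \<longlongrightarrow> ereal z) (at_left (real C))"
    if "(zroot C \<rho>1 \<longlongrightarrow> z) (at_left (real C))" for z
    using that by simp
  have super: "((\<lambda>\<rho>2. ereal (zroot C \<rho>1 \<rho>2)) \<longlongrightarrow> \<infinity>) (at_left (real C))"
    if "real C - 1 \<le> \<rho>1"
    using filterlim_zroot_at_top[OF assms that] by (simp add: tendsto_PInfty_eq_at_top)
  have "((\<lambda>\<rho>2. ereal (zroot C \<rho>1 \<rho>2)) \<longlongrightarrow> zroot_limit C \<rho>1) (at_left (real C)) \<and> 0 < zroot_limit C \<rho>1"
  proof (cases "\<rho>1 < real C - 1")
    case True
    then show ?thesis
      using Phi_roots_critical[OF assms \<rho>1 True] sub zroot_limit_eq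
      by (metis ereal_less(2))
  next
    case False
    then show ?thesis using super zroot_limit_eq[OF super] by simp
  qed
  then show "((\<lambda>\<rho>2. ereal (zroot C \<rho>1 \<rho>2)) \<longlongrightarrow> zroot_limit C \<rho>1) (at_left (real C))"
    and "0 < zroot_limit C \<rho>1" by auto
  show "\<exists>!z. z \<in> Phi_roots C \<rho>1 (real C)" if "\<rho>1 < real C - 1"
    using Phi_roots_critical[OF assms \<rho>1 that] by (metis singleton_iff)
  show "\<exists>z\<in>Phi_roots C \<rho>1 (real C). zroot_limit C \<rho>1 = ereal z" if "\<rho>1 < real C - 1"
    using Phi_roots_critical[OF assms \<rho>1 that] zroot_limit_eq[OF sub] by (metis singletonI)
  show "zroot_limit C \<rho>1 = \<infinity>" if "real C - 1 \<le> \<rho>1"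
    by (rule zroot_limit_eq[OF super[OF that]])
next
  show "\<exists>\<phi> :: real \<Rightarrow> real.
            \<phi> \<in> {real C<..} \<rightarrow> {0<..<real C - 1} \<and>
            antimono_on {real C<..} \<phi> \<and>
            (\<phi> \<longlongrightarrow> 0) at_top \<and>
            (\<phi> \<longlongrightarrow> real C - 1) (at_right (real C)) \<and>
            (\<forall>\<rho>1 \<rho>2. 0 < \<rho>1 \<and> \<rho>1 < real C \<and> real C < \<rho>2 \<longrightarrow>
               (\<rho>1 < \<phi> \<rho>2 \<longrightarrow> card (Phi_roots C \<rho>1 \<rho>2) = 2) \<and>
               (\<phi> \<rho>2 < \<rho>1 \<longrightarrow> Phi_roots C \<rho>1 \<rho>2 = {}) \<and>
               (\<rho>1 = \<phi> \<rho>2 \<longrightarrow> (\<exists>!z. z \<in> Phi_roots C \<rho>1 \<rho>2)))"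
    using assms phi_bound_range antimono_on_phi_bound phi_bound_at_top phi_bound_at_right
      card_Phi_roots_2 Phi_roots_empty Phi_roots_singleton
    by (intro exI[of _ "phi_bound C"]) auto
qed

end
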